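(* Let $n\in\mathbb{N}$ and let $T\subset\mathbb{R}^n$ be a nonempty closed regular set. Let $I\subset\mathbb{Z}_+^n$ be a finite regular set with $0\in I$, such that $\max_{i\in I}|i|=2k$, where $k\in\mathbb{N}$, and assume that $2k\,\mathrm{e}_\iota\in I$ for every $1\le\iota\le n$. Let $g=(g_i)_{i\in I}$ be a set of real numbers with $g_0=1$. Fix $\rho\in L^1(T,dt)$ with $\rho>0$ a.e. on $T$. Then the following statements (a) and (b) are equivalent: (a) There exist functions $f\in L^1_+(T,dt)$ such that $\int_T|t^i|f(t)\,dt<\infty$ and $$\int_T t^i f(t)\,dt=g_i\qquad\text{for all } i\in I;$$ (b) The functional $L:\mathbb{R}^N\to\mathbb{R}\cup\{-\infty\}$, where $N=\operatorname{card} I$, defined by $$L(\lambda)=\sum_{i\in I}g_i\lambda_i-\int_T e^{\sum_{i\in I}\lambda_i t^i}\rho(t)\,dt,\qquad \lambda=(\lambda_i)_{i\in I},$$ is bounded from above and $\sup L$ is attained in a (unique) point $\lambda^*\in\mathbb{R}^N$.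
   Context: Notation: $\mathbb{N}=\{1,2,\ldots\}$ and $\mathbb{Z}_+=\mathbb{N}\cup\{0\}$. For $t=(t_1,\ldots,t_n)\in\mathbb{R}^n$ and a multiindex $i=(i_1,\ldots,i_n)\in\mathbb{Z}_+^n$, $t^i=t_1^{i_1}\cdots t_n^{i_n}$ and $|i|=i_1+\cdots+i_n$. For $1\le\iota\le n$, $\mathrm{e}_\iota=(0,\ldots,1,\ldots,0)$ is the multiindex with $1$ in position $\iota$ and $0$ elsewhere. $dt=dt_1\cdots dt_n$ is $n$-dimensional Lebesgue measure, $\|t\|=(\sum_{\iota=1}^n t_\iota^2)^{1/2}$, and "a.e." refers to Lebesgue measure. $L^1_+(T,dt)$ is the set of all $f\in L^1(T,dt)$ with $f\ge0$ a.e. on $T$. A closed set $T\subset\mathbb{R}^n$ is called regular if for every $t\in T$ and every $\varepsilon>0$ the set $\{x\in T:\|x-t\|<\varepsilon\}$ has positive Lebesgue measure. For $i\in I$ put $\sigma_i=\{j\in\mathbb{Z}_+^n: \text{for each } 1\le m\le n,\ j_m=0 \text{ or } j_m=i_m\}$. A finite set $I\subset\mathbb{Z}_+^n$ is called regular if $\sigma_i\subset I$ for all $i\in I$. In the definition of $L$, $L(\lambda)=-\infty$ when the integral $\int_T e^{\sum_{i\in I}\lambda_i t^i}\rho(t)\,dt$ equals $+\infty$. *)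

theory Defs
  imports "HOL-Analysis.Analysis"
begin

definition mpow :: "real ^ 'n \<Rightarrow> nat ^ 'n \<Rightarrow> real" where
  "mpow t i = (\<Prod>m\<in>UNIV. (t $ m) ^ (i $ m))"

definition mdeg :: "nat ^ 'n \<Rightarrow> nat" where
  "mdeg i = (\<Sum>m\<in>UNIV. i $ m)"

definition regular_domain :: "(real ^ 'n) set \<Rightarrow> bool" where
  "regular_domain T \<longleftrightarrow>
     (\<forall>t\<in>T. \<forall>\<epsilon>>0. emeasure lebesgue {x \<in> T. norm (x - t) < \<epsilon>} > 0)"

definition sub_indices :: "nat ^ 'n \<Rightarrow> (nat ^ 'n) set" where
  "sub_indices i = {j. \<forall>m. j $ m = 0 \<or> j $ m = i $ m}"

definition regular_indices :: "(nat ^ 'n) set \<Rightarrow> bool" where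
  "regular_indices I \<longleftrightarrow> (\<forall>i\<in>I. sub_indices i \<subseteq> I)"

definition L1_nonneg :: "(real ^ 'n) set \<Rightarrow> (real ^ 'n \<Rightarrow> real) set" where
  "L1_nonneg T = {f. integrable (lebesgue_on T) f \<and> (AE t in lebesgue_on T. 0 \<le> f t)}"

definition has_moments ::
  "(real ^ 'n) set \<Rightarrow> (nat ^ 'n) set \<Rightarrow> (nat ^ 'n \<Rightarrow> real) \<Rightarrow> (real ^ 'n \<Rightarrow> real) \<Rightarrow> bool" where
  "has_moments T I g f \<longleftrightarrow>
     (\<forall>i\<in>I. integrable (lebesgue_on T) (\<lambda>t. \<bar>mpow t i\<bar> * f t) \<and>
            integral\<^sup>L (lebesgue_on T) (\<lambda>t. mpow t i * f t) = g i)"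

text \<open>The space of real families indexed by \<open>I\<close>, of dimension \<open>card I\<close>. Extensionality makes
  each family a single point, so that uniqueness of a maximizer is meaningful.\<close>

abbreviation coeff_space :: "(nat ^ 'n) set \<Rightarrow> (nat ^ 'n \<Rightarrow> real) set" where
  "coeff_space I \<equiv> I \<rightarrow>\<^sub>E UNIV"

text \<open>The integral is taken in \<open>[0, \<infinity>]\<close>, so the value is \<open>-\<infinity>\<close> exactly when it diverges.
  Truncation by \<open>ennreal\<close> is harmless since \<open>\<rho> > 0\<close> almost everywhere on \<open>T\<close>.\<close>

definition dual_functional ::
  "(real ^ 'n) set \<Rightarrow> (nat ^ 'n) set \<Rightarrow> (nat ^ 'n \<Rightarrow> real) \<Rightarrow> (real ^ 'n \<Rightarrow> real)
     \<Rightarrow> (nat ^ 'n \<Rightarrow> real) \<Rightarrow> ereal" where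
  "dual_functional T I g \<rho> l =
     ereal (\<Sum>i\<in>I. g i * l i)
     - enn2ereal (\<integral>\<^sup>+ t. ennreal (exp (\<Sum>i\<in>I. l i * mpow t i) * \<rho> t) \<partial>lebesgue_on T)"

end

theory Submission
  imports Defs "HOL-Computational_Algebra.Polynomial"
begin

text \<open>Write \<open>p\<^sub>a\<close> for the polynomial with coefficients \<open>a\<close>. Both sides of the equivalence say the
  same thing about \<open>g\<close>: whenever \<open>a \<noteq> 0\<close> and \<open>p\<^sub>a \<le> 0\<close> on \<open>T\<close>, then \<open>\<Sum> g\<^sub>i a\<^sub>i < 0\<close>
  (\<open>strictly_positive_on\<close>).

  A density \<open>f\<close> with moments \<open>g\<close> forces this condition, because \<open>\<Sum> g\<^sub>i a\<^sub>i\<close> is then the integral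
  of \<open>p\<^sub>a f\<close>, which is nonpositive and can vanish only if \<open>f\<close> does: the zero set of \<open>p\<^sub>a\<close> is null
  (\<open>AE_mpoly_nonzero\<close>), and \<open>f\<close> is not zero since \<open>g\<^sub>0 = 1\<close>.

  The condition makes the concave functional \<open>L\<close> coercive (\<open>dual_coercive\<close>). Along a direction \<open>v\<close>
  with \<open>p\<^sub>v > 0\<close> somewhere on \<open>T\<close>, the regularity of \<open>T\<close> makes the exponential integral outgrow the
  linear term; along any other direction the linear term itself tends to \<open>-\<infinity>\<close>. Since \<open>L\<close> is upper
  semicontinuous by Fatou's lemma, its supremum is attained, and strict convexity of the exponential
  makes the maximizer unique.

  If \<open>L\<close> has a unique maximizer \<open>\<lambda>\<close> and \<open>p\<^sub>a \<le> 0\<close> on \<open>T\<close>, then passing from \<open>\<lambda>\<close> to \<open>\<lambda> + a\<close> does not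
  increase the integral; if moreover \<open>\<Sum> g\<^sub>i a\<^sub>i \<ge> 0\<close>, then \<open>\<lambda> + a\<close> is another maximizer. So the
  condition holds (\<open>strictly_positive_if_unique_maximum\<close>).

  It remains to find a density from the condition (\<open>moments_if_strictly_positive\<close>). The density
  \<open>exp p\<^sub>\<lambda> \<rho>\<close> given by the maximizer \<open>\<lambda>\<close> need not work, because \<open>\<lambda>\<close> may lie on the boundary of the
  domain of \<open>L\<close>, where \<open>L\<close> has no gradient. However, the condition does not mention \<open>\<rho>\<close>, so \<open>L\<close>
  attains its maximum for every positive integrable weight. For the weight
  \<open>\<rho> exp (- \<Sum> (t\<^sup>i)\<^sup>2)\<close> the functional is finite everywhere, its gradient at the maximizer vanishes,
  and that says that the maximizing density has the moments \<open>g\<close>.\<close>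

section \<open>Zero sets of multivariate polynomials\<close>

definition mpoly :: "(nat ^ 'n) set \<Rightarrow> (nat ^ 'n \<Rightarrow> real) \<Rightarrow> real ^ 'n \<Rightarrow> real" where
  "mpoly I a t = (\<Sum>i\<in>I. a i * mpow t i)"

lemma base_digits_unique:
  fixes x y :: "nat \<Rightarrow> nat"
  assumes "\<And>m. m < n \<Longrightarrow> x m < B" and "\<And>m. m < n \<Longrightarrow> y m < B"
    and "(\<Sum>m<n. x m * B ^ m) = (\<Sum>m<n. y m * B ^ m)"
  shows "\<forall>m<n. x m = y m"
  using assms
proof (induction n arbitrary: x y)
  case 0
  then show ?case by simp
next
  case (Suc n)
  define X where "X = (\<Sum>m<n. x (Suc m) * B ^ m)"
  define Y where "Y = (\<Sum>m<n. y (Suc m) * B ^ m)"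
  have sx: "(\<Sum>m<Suc n. x m * B ^ m) = x 0 + B * X"
    unfolding X_def sum.lessThan_Suc_shift by (simp add: sum_distrib_left mult_ac)
  have sy: "(\<Sum>m<Suc n. y m * B ^ m) = y 0 + B * Y"
    unfolding Y_def sum.lessThan_Suc_shift by (simp add: sum_distrib_left mult_ac)
  have eq: "x 0 + B * X = y 0 + B * Y"
    using Suc.prems(3) sx sy by simp
  have small: "x 0 < B" "y 0 < B"
    using Suc.prems by auto
  have "x 0 = (x 0 + B * X) mod B" "y 0 = (y 0 + B * Y) mod B"
    using small by auto
  then have head: "x 0 = y 0"
    using eq by simp
  then have "X = Y"
    using eq small by auto
  then have "\<forall>m<n. x (Suc m) = y (Suc m)"
    unfolding X_def Y_def using Suc.prems by (intro Suc.IH) auto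
  with head show ?case
    using less_Suc_eq_0_disj by auto
qed

text \<open>The weights are powers of a base that exceeds every exponent occurring in \<open>I\<close>, so that the
  weighted degree of an index reads its entries off as digits (Kronecker substitution).\<close>

lemma separating_weights:
  fixes I :: "(nat ^ 'n) set"
  assumes "finite I"
  obtains w :: "'n \<Rightarrow> nat"
  where "\<And>m. w m > 0" and "inj_on (\<lambda>i. \<Sum>m\<in>UNIV. i $ m * w m) I"
proof -
  obtain h :: "'n \<Rightarrow> nat" where h: "bij_betw h UNIV {0..<CARD('n)}"
    using ex_bij_betw_finite_nat[of "UNIV :: 'n set"] by auto
  define B where "B = Suc (\<Sum>i\<in>I. \<Sum>m\<in>UNIV. i $ m)"
  have digit: "i $ m < B" if "i \<in> I" for i m
  proof -
    have "i $ m \<le> (\<Sum>m\<in>UNIV. i $ m)"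
      by (rule member_le_sum) auto
    also have "\<dots> \<le> (\<Sum>i\<in>I. \<Sum>m\<in>UNIV. i $ m)"
      using that assms by (intro member_le_sum) auto
    finally show ?thesis
      by (simp add: B_def)
  qed
  have inv: "inv h (h m) = m" for m
    using h by (simp add: bij_betw_def)
  have reindex: "(\<Sum>m\<in>UNIV. i $ m * B ^ h m) = (\<Sum>k<CARD('n). i $ (inv h k) * B ^ k)" for i
    using sum.reindex_bij_betw[OF h, of "\<lambda>k. i $ (inv h k) * B ^ k"]
    by (simp add: inv lessThan_atLeast0)
  have "inj_on (\<lambda>i. \<Sum>m\<in>UNIV. i $ m * B ^ h m) I"
  proof (rule inj_onI)
    fix i j
    assume ij: "i \<in> I" "j \<in> I"
      and "(\<Sum>m\<in>UNIV. i $ m * B ^ h m) = (\<Sum>m\<in>UNIV. j $ m * B ^ h m)"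
    then have *: "\<forall>k<CARD('n). i $ (inv h k) = j $ (inv h k)"
      unfolding reindex using digit by (intro base_digits_unique[of _ _ B]) auto
    have "i $ m = j $ m" for m
      using *[rule_format, of "h m"] bij_betwE[OF h] by (simp add: inv)
    then show "i = j"
      by (simp add: vec_eq_iff)
  qed
  moreover have "B ^ h m > 0" for m
    by (simp add: B_def)
  ultimately show ?thesis
    using that[of "\<lambda>m. B ^ h m"] by blast
qed

text \<open>Along the translated curve \<open>s \<mapsto> t + (s^w\<^sub>m)\<^sub>m\<close> each monomial \<open>i\<close> becomes a monic univariate
  polynomial whose degree is the weighted degree of \<open>i\<close>. As these degrees are distinct, no
  cancellation of leading terms can occur, wherever the curve starts.\<close>

lemma finite_zeros_along_curve:
  fixes I :: "(nat ^ 'n) set"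
  assumes fin: "finite I" and nz: "\<exists>i\<in>I. a i \<noteq> 0"
    and pos: "\<And>m. w m > 0" and inj: "inj_on (\<lambda>i. \<Sum>m\<in>UNIV. i $ m * w m) I"
  shows "finite {s. mpoly I a (t + (\<chi> m. s ^ w m)) = 0}"
proof -
  let ?W = "\<lambda>i. \<Sum>m\<in>UNIV. i $ m * w m"
  define f where "f m = [:t $ m:] + monom 1 (w m)" for m
  define P where "P i = (\<Prod>m\<in>UNIV. f m ^ (i $ m))" for i :: "nat ^ 'n"
  have deg_f: "degree (f m) = w m" for m
    unfolding f_def using pos[of m] by (subst degree_add_eq_right) (auto simp: degree_monom_eq)
  have lc_f: "lead_coeff (f m) = 1" for m
    unfolding deg_f using pos[of m] by (auto simp: f_def coeff_pCons split: nat.split)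
  have nz_f: "f m \<noteq> 0" for m
    using lc_f[of m] by auto
  have deg_P: "degree (P i) = ?W i" for i
    unfolding P_def using nz_f by (subst degree_prod_sum_eq) (auto simp: degree_power_eq deg_f)
  have lc_P: "lead_coeff (P i) = 1" for i
    by (simp add: P_def lead_coeff_prod lead_coeff_power lc_f)
  define J where "J = {i\<in>I. a i \<noteq> 0}"
  have J: "finite J" "J \<noteq> {}" "J \<subseteq> I"
    using fin nz by (auto simp: J_def)
  \<comment> \<open>the term of largest degree cannot be cancelled by any other\<close>
  have "Max (?W ` J) \<in> ?W ` J"
    using J by (intro Max_in) auto
  then obtain i0 where Max_eq: "Max (?W ` J) = ?W i0" and i0: "i0 \<in> J"
    by (rule imageE)
  have max: "?W i \<le> ?W i0" if "i \<in> J" for i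
    unfolding Max_eq[symmetric] by (rule Max_ge[OF finite_imageI[OF J(1)] imageI[OF that]])
  define Q where "Q = (\<Sum>i\<in>I. smult (a i) (P i))"
  have lower: "coeff (smult (a i) (P i)) (?W i0) = 0" if "i \<in> I - {i0}" for i
  proof (cases "i \<in> J")
    case True
    then have "?W i \<noteq> ?W i0"
      using that i0 J inj by (auto dest: inj_onD)
    with max[OF True] have "?W i < ?W i0" by simp
    then show ?thesis
      by (simp add: coeff_eq_0 deg_P)
  next
    case False
    with that show ?thesis by (simp add: J_def)
  qed
  have "coeff Q (?W i0) = (\<Sum>i\<in>I. coeff (smult (a i) (P i)) (?W i0))"
    by (simp add: Q_def coeff_sum)
  also have "\<dots> = coeff (smult (a i0) (P i0)) (?W i0)"
  proof -
    have "(\<Sum>i\<in>I - {i0}. coeff (smult (a i) (P i)) (?W i0)) = 0"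
      using lower by (intro sum.neutral) blast
    moreover have "i0 \<in> I"
      using i0 J(3) by blast
    ultimately show ?thesis
      using sum.remove[OF fin, of i0 "\<lambda>i. coeff (smult (a i) (P i)) (?W i0)"]
      by (simp only: add_0_right)
  qed
  also have "\<dots> = a i0"
    using lc_P[of i0] by (simp add: deg_P)
  finally have "Q \<noteq> 0"
    using i0 by (auto simp: J_def)
  moreover have "poly Q s = mpoly I a (t + (\<chi> m. s ^ w m))" for s
    by (simp add: Q_def P_def f_def mpoly_def mpow_def poly_sum poly_prod poly_monom)
  ultimately show ?thesis
    using poly_roots_finite[of Q] by simp
qed

lemma continuous_mpow: "continuous_on UNIV (\<lambda>t. mpow t i)"
  unfolding mpow_def by (intro continuous_intros)

lemma continuous_mpoly: "continuous_on UNIV (mpoly I a)"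
  unfolding mpoly_def[abs_def] by (intro continuous_intros continuous_mpow)

text \<open>The zero set \<open>Z\<close> is translated along a curve that meets each translate of \<open>Z\<close> in finitely many
  points. By translation invariance and Tonelli, the measure of \<open>Z\<close> times the infinite length of the
  parameter line equals the integral over all starting points of the time spent in \<open>Z\<close>, which is
  zero. The argument treats all coordinates at once and needs no induction on the dimension.\<close>

lemma AE_mpoly_nonzero:
  fixes I :: "(nat ^ 'n) set"
  assumes "finite I" and "\<exists>i\<in>I. a i \<noteq> 0"
  shows "AE t in lborel. mpoly I a t \<noteq> 0"
proof -
  obtain w :: "'n \<Rightarrow> nat" where w: "\<And>m. w m > 0" "inj_on (\<lambda>i. \<Sum>m\<in>UNIV. i $ m * w m) I"
    using separating_weights[OF assms(1)] by blast
  define c :: "real \<Rightarrow> real ^ 'n" where "c s = (\<chi> m. s ^ w m)" for s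
  define Z where "Z = {t. mpoly I a t = 0}"
  have "closed Z"
    unfolding Z_def using continuous_closed_vimage[OF closed_singleton[of 0], of "mpoly I a"] continuous_mpoly[of I a]
    by (simp add: vimage_def continuous_on_eq_continuous_at)
  then have Z [measurable]: "Z \<in> sets borel"
    by simp
  have "continuous_on UNIV c"
    unfolding c_def by (intro continuous_intros)
  then have c [measurable]: "c \<in> borel_measurable borel"
    by (simp add: borel_measurable_continuous_onI)
  have "emeasure lborel Z * \<infinity> = (\<integral>\<^sup>+ s. emeasure lborel Z \<partial>(lborel :: real measure))"
    by (simp add: emeasure_lborel_UNIV)
  also have "\<dots> = (\<integral>\<^sup>+ s. (\<integral>\<^sup>+ t. indicator Z (t + c s) \<partial>lborel) \<partial>(lborel :: real measure))"
  proof (rule nn_integral_cong)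
    fix s :: real
    have "emeasure lborel Z = (\<integral>\<^sup>+ t. indicator Z t \<partial>distr lborel borel ((+) (c s)))"
      by (simp add: lborel_distr_plus)
    also have "\<dots> = (\<integral>\<^sup>+ t. indicator Z (t + c s) \<partial>lborel)"
      by (subst nn_integral_distr) (auto simp: add.commute)
    finally show "emeasure lborel Z = (\<integral>\<^sup>+ t. indicator Z (t + c s) \<partial>lborel)" .
  qed
  also have "\<dots> = (\<integral>\<^sup>+ t. (\<integral>\<^sup>+ s. indicator Z (t + c s) \<partial>(lborel :: real measure)) \<partial>lborel)"
    by (rule lborel_pair.Fubini') simp
  also have "\<dots> = (\<integral>\<^sup>+ t. 0 \<partial>(lborel :: (real ^ 'n) measure))"
  proof (rule nn_integral_cong)
    fix t :: "real ^ 'n"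
    have "finite {s. t + c s \<in> Z}"
      unfolding Z_def c_def using finite_zeros_along_curve[OF assms w, of t] by simp
    then have "emeasure lborel {s. t + c s \<in> Z} = 0"
      by (rule emeasure_lborel_countable[OF countable_finite])
    moreover have "(\<integral>\<^sup>+ s. indicator Z (t + c s) \<partial>lborel) = (\<integral>\<^sup>+ s. indicator {s. t + c s \<in> Z} s \<partial>lborel)"
      by (intro nn_integral_cong) (auto simp: indicator_def)
    ultimately show "(\<integral>\<^sup>+ s. indicator Z (t + c s) \<partial>lborel) = 0"
      by simp
  qed
  finally have "emeasure lborel Z = 0"
    by (simp add: ennreal_mult_eq_top_iff)
  then have "Z \<in> null_sets lborel"
    by (simp add: null_setsI)
  then show ?thesis
    using AE_not_in[of Z lborel] by (simp add: Z_def)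
qed

section \<open>Regular domains and compactness of coefficient families\<close>

lemma regular_domain_meets_open:
  assumes "closed T" and "regular_domain T" and "open U" and "t0 \<in> T" and "t0 \<in> U"
  shows "\<not> (AE t in lebesgue_on T. t \<notin> U)"
proof
  assume ae: "AE t in lebesgue_on T. t \<notin> U"
  obtain e where e: "e > 0" "ball t0 e \<subseteq> U"
    using assms(3,5) by (auto simp: open_contains_ball)
  let ?A = "{x \<in> T. norm (x - t0) < e}"
  have T: "T \<in> sets lebesgue"
    using assms(1) by auto
  have "AE t in lebesgue. t \<in> T \<longrightarrow> t \<notin> U"
    using ae T by (simp add: AE_restrict_space_iff)
  then have ae': "AE t in lebesgue. t \<notin> ?A"
  proof eventually_elim
    case (elim t)
    show ?case
    proof
      assume "t \<in> ?A"
      then have "t \<in> T" "t \<in> ball t0 e"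
        by (auto simp: dist_norm norm_minus_commute)
      with elim e show False by auto
    qed
  qed
  have "?A = T \<inter> ball t0 e"
    by (auto simp: dist_norm norm_minus_commute)
  moreover have "ball t0 e \<in> sets lebesgue"
    by simp
  ultimately have "?A \<in> sets lebesgue"
    using T by (simp only: sets.Int)
  with ae' have "emeasure lebesgue ?A = 0"
    using AE_iff_null_sets[of ?A lebesgue] by auto
  moreover have "emeasure lebesgue ?A > 0"
    using assms(2,4) e(1) by (simp add: regular_domain_def)
  ultimately show False by simp
qed

lemma bounded_coordinates_convergent_subsequence:
  fixes u :: "nat \<Rightarrow> 'a \<Rightarrow> real"
  assumes "finite I" and bdd: "\<And>m i. i \<in> I \<Longrightarrow> \<bar>u m i\<bar> \<le> C"
  obtains v s where "strict_mono s" and "\<And>i. i \<in> I \<Longrightarrow> (\<lambda>m. u (s m) i) \<longlonglongrightarrow> v i"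
proof -
  have "bounded ((\<lambda>x. x i) ` range u)" if "i \<in> I" for i
    using bdd[OF that] by (auto simp: bounded_iff)
  then have "\<forall>d\<subseteq>I. \<exists>v s. strict_mono s \<and>
      (\<forall>e>0. eventually (\<lambda>m. \<forall>i\<in>d. dist (u (s m) i) (v i) < e) sequentially)"
    by (intro compact_lemma_general[where proj = "\<lambda>x i. x i" and unproj = "\<lambda>x. x"] assms(1)) auto
  then obtain v s where s: "strict_mono s"
    and *: "\<forall>e>0. eventually (\<lambda>m. \<forall>i\<in>I. dist (u (s m) i) (v i) < e) sequentially"
    by blast
  have "(\<lambda>m. u (s m) i) \<longlonglongrightarrow> v i" if "i \<in> I" for i
  proof (rule tendstoI)
    fix e :: real
    assume "e > 0"
    with * have "eventually (\<lambda>m. \<forall>i\<in>I. dist (u (s m) i) (v i) < e) sequentially"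
      by simp
    then show "eventually (\<lambda>m. dist (u (s m) i) (v i) < e) sequentially"
      by eventually_elim (use that in auto)
  qed
  with s that show ?thesis by blast
qed

section \<open>Strict positivity of the moment functional\<close>

text \<open>With \<open>a\<close> replaced by \<open>-a\<close>: the functional that sends each polynomial \<open>p\<^sub>a\<close> to
  \<open>\<Sum> g\<^sub>i a\<^sub>i\<close> is strictly positive on nonzero polynomials that are nonnegative on \<open>T\<close>. The version
  with reversed signs is the one that meets the exponent in the dual functional.\<close>

definition strictly_positive_on ::
  "(real ^ 'n) set \<Rightarrow> (nat ^ 'n) set \<Rightarrow> (nat ^ 'n \<Rightarrow> real) \<Rightarrow> bool" where
  "strictly_positive_on T I g \<longleftrightarrow>
     (\<forall>a. (\<exists>i\<in>I. a i \<noteq> 0) \<longrightarrow> (\<forall>t\<in>T. mpoly I a t \<le> 0) \<longrightarrow> (\<Sum>i\<in>I. g i * a i) < 0)"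

locale moment_setting =
  fixes T :: "(real ^ 'n) set" and I :: "(nat ^ 'n) set" and g :: "nat ^ 'n \<Rightarrow> real"
  assumes T_nonempty: "T \<noteq> {}" and T_closed: "closed T" and T_regular: "regular_domain T"
    and finite_I: "finite I"
begin

abbreviation (input) N where "N \<equiv> lebesgue_on T"

lemma T_lebesgue: "T \<in> sets lebesgue"
  using T_closed by auto

lemma measurable_mpow [measurable]: "(\<lambda>t. mpow t i) \<in> borel_measurable N"
  by (rule continuous_imp_measurable_on_sets_lebesgue[OF _ T_lebesgue])
     (rule continuous_on_subset[OF continuous_mpow subset_UNIV])

lemma measurable_mpoly [measurable]: "mpoly I a \<in> borel_measurable N"
  by (rule continuous_imp_measurable_on_sets_lebesgue[OF _ T_lebesgue])
     (rule continuous_on_subset[OF continuous_mpoly subset_UNIV])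

lemma AE_on_T: "(\<And>t. t \<in> T \<Longrightarrow> P t) \<Longrightarrow> AE t in N. P t"
  by (rule AE_I2) simp

lemma N_not_null: "\<not> (AE t in N. False)"
  using regular_domain_meets_open[OF T_closed T_regular open_UNIV] T_nonempty by auto

lemma AE_mpoly_nonzero_on:
  assumes "\<exists>i\<in>I. a i \<noteq> 0"
  shows "AE t in N. mpoly I a t \<noteq> 0"
proof -
  have "AE t in lebesgue. mpoly I a t \<noteq> 0"
    using AE_mpoly_nonzero[OF finite_I assms] by (rule AE_completion)
  then have "AE t in lebesgue. t \<in> T \<longrightarrow> mpoly I a t \<noteq> 0"
    by eventually_elim simp
  then show ?thesis
    using T_lebesgue by (simp add: AE_restrict_space_iff)
qed

lemma mpoly_tendsto:
  assumes "\<And>i. i \<in> I \<Longrightarrow> (\<lambda>m. l m i) \<longlonglongrightarrow> v i"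
  shows "(\<lambda>m. mpoly I (l m) t) \<longlonglongrightarrow> mpoly I v t"
  unfolding mpoly_def using assms by (intro tendsto_intros)

abbreviation pairing where "pairing l \<equiv> (\<Sum>i\<in>I. g i * l i)"

lemma pairing_tendsto:
  assumes "\<And>i. i \<in> I \<Longrightarrow> (\<lambda>m. l m i) \<longlonglongrightarrow> v i"
  shows "(\<lambda>m. pairing (l m)) \<longlonglongrightarrow> pairing v"
  using assms by (intro tendsto_intros)

text \<open>If \<open>p\<^sub>a \<le> 0\<close> had integral zero against \<open>f\<close>, then \<open>f\<close> would vanish almost everywhere, against
  \<open>g\<^sub>0 = 1\<close>.\<close>

lemma strictly_positive_if_moments:
  assumes "0 \<in> I" and "g 0 = 1" and "f \<in> L1_nonneg T" and "has_moments T I g f"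
  shows "strictly_positive_on T I g"
  unfolding strictly_positive_on_def
proof (intro allI impI)
  fix a
  assume nz: "\<exists>i\<in>I. a i \<noteq> 0" and le: "\<forall>t\<in>T. mpoly I a t \<le> 0"
  have f: "integrable N f" and f_nn: "AE t in N. 0 \<le> f t"
    using assms(3) by (auto simp: L1_nonneg_def)
  have [measurable]: "f \<in> borel_measurable N"
    using f by auto
  have int: "integrable N (\<lambda>t. mpow t i * f t)" if "i \<in> I" for i
  proof (rule Bochner_Integration.integrable_bound)
    show "integrable N (\<lambda>t. \<bar>mpow t i\<bar> * f t)"
      using assms(4) that by (simp add: has_moments_def)
  qed (auto simp: abs_mult)
  have mom: "integral\<^sup>L N (\<lambda>t. mpow t i * f t) = g i" if "i \<in> I" for i
    using assms(4) that by (simp add: has_moments_def)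
  have eq: "mpoly I a t * f t = (\<Sum>i\<in>I. a i * (mpow t i * f t))" for t
    by (simp add: mpoly_def sum_distrib_right mult.assoc)
  have int_p: "integrable N (\<lambda>t. mpoly I a t * f t)"
    unfolding eq using int by (intro Bochner_Integration.integrable_sum integrable_mult_right)
  have val: "integral\<^sup>L N (\<lambda>t. mpoly I a t * f t) = pairing a"
    unfolding eq using int mom by (subst Bochner_Integration.integral_sum) (auto intro!: sum.cong)
  have nonpos: "AE t in N. 0 \<le> - (mpoly I a t * f t)"
    using f_nn AE_on_T[of "\<lambda>t. mpoly I a t \<le> 0"] le
    by (auto elim!: eventually_elim2 simp: mult_nonpos_nonneg)
  have "pairing a \<noteq> 0"
  proof
    assume "pairing a = 0"
    then have "AE t in N. - (mpoly I a t * f t) = 0"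
      using integral_nonneg_eq_0_iff_AE[OF integrable_minus[OF int_p] nonpos] val by simp
    with AE_mpoly_nonzero_on[OF nz] have "AE t in N. mpow t 0 * f t = 0"
      by eventually_elim auto
    then have "integral\<^sup>L N (\<lambda>t. mpow t 0 * f t) = 0"
      by (rule integral_eq_zero_AE)
    with mom[OF assms(1)] assms(2) show False by simp
  qed
  moreover have "pairing a \<le> 0"
    using integral_nonneg_AE[OF nonpos] val by simp
  ultimately show "pairing a < 0" by simp
qed

end

section \<open>Maximizing the dual functional\<close>

locale weighted_moment_setting = moment_setting T I g
  for T :: "(real ^ 'n) set" and I g +
  fixes \<rho> :: "real ^ 'n \<Rightarrow> real"
  assumes weight_integrable: "integrable N \<rho>" and weight_pos: "AE t in N. \<rho> t > 0"
begin

lemma measurable_weight [measurable]: "\<rho> \<in> borel_measurable N"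
  using weight_integrable by auto

definition normalizer where
  "normalizer l = (\<integral>\<^sup>+ t. ennreal (exp (mpoly I l t) * \<rho> t) \<partial>N)"

abbreviation dual where "dual \<equiv> dual_functional T I g \<rho>"

lemma dual_eq: "dual l = ereal (pairing l) - enn2ereal (normalizer l)"
  by (simp add: dual_functional_def normalizer_def mpoly_def)

lemma mpoly_cong: "(\<And>i. i \<in> I \<Longrightarrow> l i = l' i) \<Longrightarrow> mpoly I l = mpoly I l'"
  by (auto simp: mpoly_def fun_eq_iff intro!: sum.cong)

lemma dual_cong: "(\<And>i. i \<in> I \<Longrightarrow> l i = l' i) \<Longrightarrow> dual l = dual l'"
  unfolding dual_eq normalizer_def using mpoly_cong[of l l'] by (auto intro!: arg_cong2[where f = "(-)"] sum.cong)

lemma dual_restrict: "dual (restrict l I) = dual l"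
  by (rule dual_cong) simp

lemma dual_finite_normalizer:
  assumes "integrable N (\<lambda>t. exp (mpoly I l t) * \<rho> t)"
  shows "dual l = ereal (pairing l - (\<integral>t. exp (mpoly I l t) * \<rho> t \<partial>N))"
proof -
  have "AE t in N. 0 \<le> exp (mpoly I l t) * \<rho> t"
    using weight_pos by eventually_elim simp
  then show ?thesis
    using nn_integral_eq_integral[OF assms] integral_nonneg_AE[where M = N and f = "\<lambda>t. exp (mpoly I l t) * \<rho> t"]
    by (simp add: dual_eq normalizer_def enn2ereal_ennreal)
qed

text \<open>Superlevel sets are expressed through the normalizer in \<open>[0, \<infinity>]\<close>, so that limit arguments can
  use Fatou's lemma without extended subtraction.\<close>

lemma dual_ge_iff:
  "ereal c \<le> dual l \<longleftrightarrow> c \<le> pairing l \<and> normalizer l \<le> ennreal (pairing l - c)"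
proof (cases "normalizer l")
  case (real r)
  then show ?thesis
    by (auto simp: dual_eq enn2ereal_ennreal ennreal_le_iff2)
next
  case top
  then show ?thesis by (simp add: dual_eq top_unique)
qed

lemma dual_zero: "dual (\<lambda>_. 0) = ereal (- (\<integral>t. \<rho> t \<partial>N))"
  using dual_finite_normalizer[of "\<lambda>_. 0"] weight_integrable by (simp add: mpoly_def)

lemma integrable_if_above:
  assumes "ereal c \<le> dual l"
  shows "integrable N (\<lambda>t. exp (mpoly I l t) * \<rho> t)"
proof (rule integrableI_nonneg)
  show "AE t in N. 0 \<le> exp (mpoly I l t) * \<rho> t"
    using weight_pos by eventually_elim simp
  show "(\<integral>\<^sup>+ t. ennreal (exp (mpoly I l t) * \<rho> t) \<partial>N) < \<infinity>"
  proof -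
    have "normalizer l \<le> ennreal (pairing l - c)"
      using assms by (simp only: dual_ge_iff)
    also have "\<dots> < \<infinity>"
      by simp
    finally show ?thesis
      unfolding normalizer_def .
  qed
qed simp

lemma dual_upper_semicontinuous:
  assumes lim: "\<And>i. i \<in> I \<Longrightarrow> (\<lambda>m. l m i) \<longlonglongrightarrow> v i"
    and ge: "eventually (\<lambda>m. ereal c \<le> dual (l m)) sequentially"
  shows "ereal c \<le> dual v"
proof -
  have ev: "eventually (\<lambda>m. c \<le> pairing (l m) \<and> normalizer (l m) \<le> ennreal (pairing (l m) - c)) sequentially"
    using ge by (simp only: dual_ge_iff)
  have "c \<le> pairing v"
    by (rule tendsto_lowerbound[OF pairing_tendsto[OF lim]]) (use ev in \<open>auto elim: eventually_mono\<close>)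
  moreover have "normalizer v \<le> ennreal (pairing v - c)"
  proof -
    have "(\<lambda>m. ennreal (exp (mpoly I (l m) t) * \<rho> t)) \<longlonglongrightarrow> ennreal (exp (mpoly I v t) * \<rho> t)" for t
      by (intro tendsto_ennrealI tendsto_intros mpoly_tendsto lim)
    then have "ennreal (exp (mpoly I v t) * \<rho> t) = liminf (\<lambda>m. ennreal (exp (mpoly I (l m) t) * \<rho> t))" for t
      by (intro lim_imp_Liminf[symmetric]) simp_all
    then have "normalizer v = (\<integral>\<^sup>+ t. liminf (\<lambda>m. ennreal (exp (mpoly I (l m) t) * \<rho> t)) \<partial>N)"
      unfolding normalizer_def by simp
    also have "\<dots> \<le> liminf (\<lambda>m. normalizer (l m))"
      unfolding normalizer_def by (rule nn_integral_liminf) simp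
    also have "\<dots> \<le> liminf (\<lambda>m. ennreal (pairing (l m) - c))"
      using ev by (intro Liminf_mono) (auto elim: eventually_mono)
    also have "\<dots> = ennreal (pairing v - c)"
      by (intro lim_imp_Liminf tendsto_ennrealI tendsto_diff tendsto_const pairing_tendsto lim) simp
    finally show ?thesis .
  qed
  ultimately show ?thesis
    by (simp add: dual_ge_iff)
qed

text \<open>An unbounded sequence in a superlevel set is normalized to \<open>l\<^sub>m = r\<^sub>m u\<^sub>m\<close> with \<open>r\<^sub>m \<rightarrow> \<infinity>\<close> and
  \<open>u\<^sub>m \<rightarrow> v \<noteq> 0\<close>. If \<open>p\<^sub>v \<le> 0\<close> on \<open>T\<close>, strict positivity sends the linear part to \<open>-\<infinity>\<close>. Otherwise
  \<open>p\<^sub>v > 0\<close> on a subset of \<open>T\<close> of positive measure, where \<open>exp (r\<^sub>m p\<^bsub>u(m)\<^esub>) \<rho> / r\<^sub>m\<close> tends to infinity,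
  although its integral stays bounded, since the value of the dual functional is at least \<open>c\<close> and
  the linear part grows at most like \<open>r\<^sub>m\<close>. This contradicts Fatou's lemma.\<close>

lemma dual_coercive:
  assumes pos: "strictly_positive_on T I g"
  shows "\<exists>R. \<forall>l. ereal c \<le> dual l \<longrightarrow> (\<Sum>i\<in>I. \<bar>l i\<bar>) \<le> R"
proof (rule ccontr)
  assume "\<not> ?thesis"
  then have "\<exists>l. ereal c \<le> dual l \<and> R < (\<Sum>i\<in>I. \<bar>l i\<bar>)" for R
    by (simp add: not_le)
  then have "\<forall>m. \<exists>l. ereal c \<le> dual l \<and> real (Suc m) < (\<Sum>i\<in>I. \<bar>l i\<bar>)"
    by (rule allI)
  then obtain l where l: "\<And>m. ereal c \<le> dual (l m)" "\<And>m. real (Suc m) < (\<Sum>i\<in>I. \<bar>l m i\<bar>)"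
    by metis
  define r where "r m = (\<Sum>i\<in>I. \<bar>l m i\<bar>)" for m
  define u where "u m i = l m i / r m" for m i
  have r_gt: "real (Suc m) < r m" for m
    using l(2)[of m] by (simp add: r_def)
  have r1: "1 \<le> r m" and r0: "0 < r m" for m
    using r_gt[of m] by auto
  have l_eq: "l m i = r m * u m i" for m i
    using r0[of m] by (simp add: u_def)
  have u_sum: "(\<Sum>i\<in>I. \<bar>u m i\<bar>) = 1" for m
    using r0[of m] by (simp add: u_def abs_divide flip: sum_divide_distrib r_def)
  have u_le: "\<bar>u m i\<bar> \<le> 1" if "i \<in> I" for m i
    using member_le_sum[of i I "\<lambda>i. \<bar>u m i\<bar>"] that finite_I u_sum[of m] by simp
  obtain v s where s: "strict_mono s" and v: "\<And>i. i \<in> I \<Longrightarrow> (\<lambda>m. u (s m) i) \<longlonglongrightarrow> v i"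
    by (rule bounded_coordinates_convergent_subsequence[OF finite_I, of u 1]) (use u_le in auto)
  have "(\<lambda>m. \<Sum>i\<in>I. \<bar>u (s m) i\<bar>) \<longlonglongrightarrow> (\<Sum>i\<in>I. \<bar>v i\<bar>)"
    using v by (intro tendsto_intros)
  then have "(\<Sum>i\<in>I. \<bar>v i\<bar>) = 1"
    unfolding u_sum by (simp add: LIMSEQ_const_iff)
  then have nz: "\<exists>i\<in>I. v i \<noteq> 0"
    by (auto intro: ccontr)
  have "filterlim (\<lambda>m. real (s m)) at_top sequentially"
    by (rule filterlim_compose[OF filterlim_real_sequentially filterlim_subseq[OF s]])
  then have r_lim: "filterlim (\<lambda>m. r (s m)) at_top sequentially"
  proof (rule filterlim_at_top_mono)
    have "real (s m) \<le> r (s m)" for m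
      using r_gt[of "s m"] by simp
    then show "eventually (\<lambda>m. real (s m) \<le> r (s m)) sequentially"
      by simp
  qed
  have pair_l: "pairing (l m) = r m * pairing (u m)" for m
    by (simp add: l_eq sum_distrib_left mult_ac)
  have mpoly_l: "mpoly I (l m) t = r m * mpoly I (u m) t" for m t
    by (simp add: mpoly_def l_eq sum_distrib_left mult_ac)
  have above: "c \<le> pairing (l m)" "normalizer (l m) \<le> ennreal (pairing (l m) - c)" for m
    using l(1)[of m] by (auto simp: dual_ge_iff)
  show False
  proof (cases "\<forall>t\<in>T. mpoly I v t \<le> 0")
    case True
    then have "pairing v < 0"
      using pos nz by (simp add: strictly_positive_on_def)
    with pairing_tendsto[of "\<lambda>m. u (s m)" v, OF v] r_lim
    have "filterlim (\<lambda>m. r (s m) * pairing (u (s m))) at_bot sequentially"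
      by (subst mult.commute) (rule filterlim_tendsto_neg_mult_at_bot)
    then have "eventually (\<lambda>m. pairing (l (s m)) < c) sequentially"
      by (simp add: pair_l filterlim_at_bot_dense)
    then obtain m where "pairing (l (s m)) < c"
      by (auto simp: eventually_sequentially)
    with above(1)[of "s m"] show False by simp
  next
    case False
    then obtain t0 where t0: "t0 \<in> T" "0 < mpoly I v t0"
      by (auto simp: not_le)
    define U where "U = {t. 0 < mpoly I v t}"
    have "open U"
      unfolding U_def by (rule open_Collect_less[OF continuous_on_const continuous_mpoly])
    \<comment> \<open>bounds the linear part minus \<open>c\<close> after division by \<open>r m \<ge> 1\<close>, as the \<open>u m\<close> are normalized\<close>
    define K where "K = (\<Sum>i\<in>I. \<bar>g i\<bar>) + \<bar>c\<bar>"
    define h where "h m t = ennreal (exp (mpoly I (l m) t) * \<rho> t / r m)" for m t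
    have h_int: "(\<integral>\<^sup>+ t. h m t \<partial>N) \<le> ennreal K" for m
    proof -
      have "pairing (u m) \<le> (\<Sum>i\<in>I. \<bar>g i\<bar>)"
      proof (rule sum_mono)
        fix i assume "i \<in> I"
        have "g i * u m i \<le> \<bar>g i\<bar> * \<bar>u m i\<bar>"
          by (metis abs_ge_self abs_mult)
        also have "\<dots> \<le> \<bar>g i\<bar>"
          using u_le[OF \<open>i \<in> I\<close>] by (simp add: mult_left_le)
        finally show "g i * u m i \<le> \<bar>g i\<bar>" .
      qed
      then have "r m * pairing (u m) \<le> r m * (\<Sum>i\<in>I. \<bar>g i\<bar>)"
        using r0[of m] by simp
      moreover have "\<bar>c\<bar> \<le> r m * \<bar>c\<bar>"
        using r1[of m] by (simp add: mult_le_cancel_right1)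
      ultimately have "pairing (l m) - c \<le> r m * K"
        by (simp add: pair_l K_def algebra_simps)
      then have le: "(pairing (l m) - c) / r m \<le> K"
        using r0[of m] by (simp add: pos_divide_le_eq mult.commute)
      have "h m t = ennreal (1 / r m) * ennreal (exp (mpoly I (l m) t) * \<rho> t)" for t
        using r0[of m] by (simp add: h_def flip: ennreal_mult')
      then have "(\<integral>\<^sup>+ t. h m t \<partial>N) = ennreal (1 / r m) * normalizer (l m)"
        unfolding normalizer_def by (simp add: nn_integral_cmult)
      also have "\<dots> \<le> ennreal (1 / r m) * ennreal (pairing (l m) - c)"
        using above(2) by (intro mult_left_mono) auto
      also have "\<dots> = ennreal ((pairing (l m) - c) / r m)"
        using r0[of m] by (simp flip: ennreal_mult')
      finally show ?thesis
        using ennreal_leI[OF le] by (rule order_trans)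
    qed
    have h_meas [measurable]: "h m \<in> borel_measurable N" for m
      unfolding h_def by simp
    have "(\<integral>\<^sup>+ t. liminf (\<lambda>m. h (s m) t) \<partial>N) \<le> liminf (\<lambda>m. \<integral>\<^sup>+ t. h (s m) t \<partial>N)"
      by (rule nn_integral_liminf) simp
    also have "\<dots> \<le> liminf (\<lambda>m. ennreal K)"
      using h_int by (intro Liminf_mono) auto
    also have "\<dots> < \<infinity>"
      by (simp add: Liminf_const)
    finally have "AE t in N. liminf (\<lambda>m. h (s m) t) \<noteq> \<infinity>"
      by (intro nn_integral_PInf_AE) auto
    then have "AE t in N. t \<notin> U"
      using weight_pos
    proof eventually_elim
      case (elim t)
      show ?case
      proof
        assume "t \<in> U"
        then have pv: "0 < mpoly I v t"
          by (simp add: U_def)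
        have p_lim: "(\<lambda>m. mpoly I (u (s m)) t) \<longlonglongrightarrow> mpoly I v t"
          by (rule mpoly_tendsto[OF v])
        have "(\<lambda>m. (mpoly I (u (s m)) t)\<^sup>2 / 2 * \<rho> t) \<longlonglongrightarrow> (mpoly I v t)\<^sup>2 / 2 * \<rho> t"
          by (intro tendsto_intros p_lim) simp
        moreover have "0 < (mpoly I v t)\<^sup>2 / 2 * \<rho> t"
          using pv elim(2) by simp
        ultimately have quad: "filterlim (\<lambda>m. (mpoly I (u (s m)) t)\<^sup>2 / 2 * \<rho> t * r (s m)) at_top sequentially"
          using r_lim by (rule filterlim_tendsto_pos_mult_at_top)
        have "eventually (\<lambda>m. 0 < mpoly I (u (s m)) t) sequentially"
          using order_tendstoD(1)[OF p_lim pv] .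
        then have "eventually (\<lambda>m. (mpoly I (u (s m)) t)\<^sup>2 / 2 * \<rho> t * r (s m)
            \<le> exp (mpoly I (l (s m)) t) * \<rho> t / r (s m)) sequentially"
        proof eventually_elim
          case (elim m)
          let ?x = "mpoly I (u (s m)) t" and ?r = "r (s m)"
          \<comment> \<open>\<open>exp y \<ge> y\<^sup>2 / 2\<close> still leaves one factor \<open>r\<close> after the division by \<open>r\<close>\<close>
          have "0 \<le> ?r * ?x"
            using elim r0[of "s m"] by simp
          then have "(?r * ?x)\<^sup>2 / 2 \<le> exp (?r * ?x)"
            using exp_lower_Taylor_quadratic[of "?r * ?x"] by linarith
          then have "(?r * ?x)\<^sup>2 / 2 * \<rho> t / ?r \<le> exp (?r * ?x) * \<rho> t / ?r"
            using r0[of "s m"] \<open>0 < \<rho> t\<close> by (intro divide_right_mono mult_right_mono) auto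
          then show ?case
            using r0[of "s m"] by (simp add: mpoly_l power2_eq_square field_simps)
        qed
        then have "filterlim (\<lambda>m. exp (mpoly I (l (s m)) t) * \<rho> t / r (s m)) at_top sequentially"
          by (rule filterlim_at_top_mono[OF quad])
        then have "(\<lambda>m. h (s m) t) \<longlonglongrightarrow> \<infinity>"
          unfolding h_def by (auto simp: tendsto_top_iff_ennreal filterlim_at_top_dense ennreal_less_iff elim: eventually_mono)
        then have "liminf (\<lambda>m. h (s m) t) = \<infinity>"
          by (intro lim_imp_Liminf) auto
        with elim(1) show False by simp
      qed
    qed
    moreover have "t0 \<in> U"
      using t0 by (simp add: U_def)
    ultimately show False
      using regular_domain_meets_open[OF T_closed T_regular \<open>open U\<close> t0(1)] by simp
  qed
qed

lemma dual_attains_maximum: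
  assumes pos: "strictly_positive_on T I g"
  obtains v where "v \<in> coeff_space I" and "\<And>l. dual l \<le> dual v"
proof -
  define S where "S = (SUP l. dual l)"
  obtain f where f: "incseq f" "range f \<subseteq> range dual" "S = (SUP m::nat. f m)"
    unfolding S_def using Sup_countable_SUP[of "range dual"] by auto
  then have "\<forall>m. \<exists>l. f m = dual l"
    by auto
  then obtain l where l: "\<And>m. f m = dual (l m)"
    by metis
  have ev: "eventually (\<lambda>m. ereal c \<le> dual (l m)) sequentially" if c: "ereal c < S" for c
  proof -
    obtain M where "ereal c < f M"
      using c f(3) by (auto simp: less_SUP_iff)
    then have "ereal c \<le> dual (l m)" if "m \<ge> M" for m
      using incseqD[OF f(1) that] by (simp add: l)
    then show ?thesis
      by (auto simp: eventually_sequentially)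
  qed
  \<comment> \<open>a real number below the finite value at \<open>0\<close>, so that the tail of a maximizing sequence lies in
    one superlevel set\<close>
  define c0 where "c0 = - (\<integral>t. \<rho> t \<partial>N) - 1"
  have "ereal c0 < dual (\<lambda>_. 0)"
    by (simp add: dual_zero c0_def)
  also have "\<dots> \<le> S"
    unfolding S_def by (rule SUP_upper) simp
  finally obtain M where M: "\<And>m. m \<ge> M \<Longrightarrow> ereal c0 \<le> dual (l m)"
    using ev[of c0] by (auto simp: eventually_sequentially)
  obtain R where R: "\<And>l. ereal c0 \<le> dual l \<Longrightarrow> (\<Sum>i\<in>I. \<bar>l i\<bar>) \<le> R"
    using dual_coercive[OF pos, of c0] by blast
  have bdd: "\<bar>l (m + M) i\<bar> \<le> R" if "i \<in> I" for m i
    using member_le_sum[of i I "\<lambda>i. \<bar>l (m + M) i\<bar>"] that finite_I R[OF M[of "m + M"]] by simp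
  obtain v s where s: "strict_mono s" and v: "\<And>i. i \<in> I \<Longrightarrow> (\<lambda>m. l (s m + M) i) \<longlonglongrightarrow> v i"
    by (rule bounded_coordinates_convergent_subsequence[OF finite_I, of "\<lambda>m. l (m + M)" R])
      (use bdd in auto)
  have ge: "ereal c \<le> dual v" if "ereal c < S" for c
  proof (rule dual_upper_semicontinuous[of "\<lambda>m. l (s m + M)", OF v])
    have "filterlim (\<lambda>m. s m + M) sequentially sequentially"
      by (rule filterlim_compose[OF filterlim_add_const_nat_at_top filterlim_subseq[OF s]])
    then show "eventually (\<lambda>m. ereal c \<le> dual (l (s m + M))) sequentially"
      using ev[OF that] by (rule eventually_compose_filterlim[rotated])
  qed
  have "S \<le> dual v"
  proof (rule ccontr)
    assume "\<not> S \<le> dual v"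
    then obtain c where "dual v < ereal c" "ereal c < S"
      using ereal_dense2[of "dual v" S] by (auto simp: not_le)
    with ge[of c] show False
      by simp
  qed
  moreover have "dual l \<le> S" for l
    unfolding S_def by (rule SUP_upper) simp
  ultimately have "dual l \<le> dual (restrict v I)" for l
    unfolding dual_restrict by (rule order_trans[rotated])
  then show ?thesis
    by (rule that[rotated]) simp
qed

text \<open>At the midpoint of two maximizers the mean of the two densities exceeds the midpoint density by
  \<open>(exp (p\<^sub>l / 2) - exp (p\<^bsub>l'\<^esub> / 2))\<^sup>2 \<rho> / 2\<close>. Maximality bounds the integral of this excess by zero,
  although it is positive wherever \<open>p\<^sub>l\<close> and \<open>p\<^bsub>l'\<^esub>\<close> differ.\<close>

lemma dual_maximum_unique:
  assumes "l \<in> coeff_space I" and "l' \<in> coeff_space I"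
    and max: "\<And>l''. dual l'' \<le> dual l" and max': "\<And>l''. dual l'' \<le> dual l'"
  shows "l = l'"
proof (rule ccontr)
  assume "l \<noteq> l'"
  then obtain j where j: "j \<in> I" "l j \<noteq> l' j"
    using PiE_ext[OF assms(1,2)] by blast
  define F where "F a t = exp (mpoly I a t) * \<rho> t" for a t
  define mid where "mid i = (l i + l' i) / 2" for i
  define A where "A t = exp (mpoly I l t / 2)" for t
  define B where "B t = exp (mpoly I l' t / 2)" for t
  have F_l: "F l t = (A t)\<^sup>2 * \<rho> t" and F_l': "F l' t = (B t)\<^sup>2 * \<rho> t" for t
    by (simp_all add: F_def A_def B_def power2_eq_square flip: exp_add)
  have "mpoly I mid t = mpoly I l t / 2 + mpoly I l' t / 2" for t
    unfolding mpoly_def mid_def sum_divide_distrib sum.distrib[symmetric]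
    by (intro sum.cong) (auto simp: field_simps)
  then have F_mid: "F mid t = A t * B t * \<rho> t" for t
    by (simp add: F_def A_def B_def exp_add)
  define c where "c = - (\<integral>t. \<rho> t \<partial>N)"
  have "ereal c \<le> dual l" "ereal c \<le> dual l'"
    using max[of "\<lambda>_. 0"] max'[of "\<lambda>_. 0"] by (simp_all add: dual_zero c_def)
  then have int: "integrable N (F l)" "integrable N (F l')"
    unfolding F_def by (auto intro: integrable_if_above)
  have gap: "(F l t + F l' t) / 2 - F mid t = (A t - B t)\<^sup>2 / 2 * \<rho> t" for t
    by (simp add: F_l F_l' F_mid power2_eq_square field_simps)
  have int_mid: "integrable N (F mid)"
  proof (rule Bochner_Integration.integrable_bound)
    show "integrable N (\<lambda>t. (F l t + F l' t) / 2)"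
      using int by auto
    show "F mid \<in> borel_measurable N"
      unfolding F_def by simp
    show "AE t in N. norm (F mid t) \<le> norm ((F l t + F l' t) / 2)"
      using weight_pos
    proof eventually_elim
      case (elim t)
      then have "0 \<le> F mid t" "0 \<le> (A t - B t)\<^sup>2 / 2 * \<rho> t"
        by (simp_all add: F_def)
      with gap[of t] have "0 \<le> F mid t" "F mid t \<le> (F l t + F l' t) / 2"
        by linarith+
      then show ?case by simp
    qed
  qed
  define D where "D t = (F l t + F l' t) / 2 - F mid t" for t
  have int_D: "integrable N D"
    unfolding D_def using int int_mid by auto
  have dual_val: "dual a = ereal (pairing a - (\<integral>t. F a t \<partial>N))" if "integrable N (F a)" for a
    using dual_finite_normalizer[of a] that unfolding F_def .
  have "pairing mid = (pairing l + pairing l') / 2"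
    unfolding mid_def sum.distrib[symmetric] sum_divide_distrib
    by (intro sum.cong) (auto simp: field_simps)
  moreover have "pairing mid - (\<integral>t. F mid t \<partial>N) \<le> pairing l - (\<integral>t. F l t \<partial>N)"
    "pairing mid - (\<integral>t. F mid t \<partial>N) \<le> pairing l' - (\<integral>t. F l' t \<partial>N)"
    using max[of mid] max'[of mid] by (simp_all add: dual_val int int_mid)
  ultimately have "((\<integral>t. F l t \<partial>N) + (\<integral>t. F l' t \<partial>N)) / 2 - (\<integral>t. F mid t \<partial>N) \<le> 0"
    by argo
  then have D_le: "(\<integral>t. D t \<partial>N) \<le> 0"
    unfolding D_def using int int_mid by simp
  have "\<exists>i\<in>I. l i - l' i \<noteq> 0"
    using j by auto
  then have "AE t in N. mpoly I (\<lambda>i. l i - l' i) t \<noteq> 0"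
    by (rule AE_mpoly_nonzero_on)
  then have D_pos: "AE t in N. 0 < D t"
    using weight_pos
  proof eventually_elim
    case (elim t)
    then have "mpoly I l t \<noteq> mpoly I l' t"
      by (simp add: mpoly_def left_diff_distrib sum_subtractf)
    then have "A t \<noteq> B t"
      by (simp add: A_def B_def)
    then show ?case
      using elim(2) by (simp add: D_def gap)
  qed
  then have D_nn: "AE t in N. 0 \<le> D t"
    by (auto elim: eventually_mono)
  then have "(\<integral>t. D t \<partial>N) = 0"
    using integral_nonneg_AE[OF D_nn] D_le by simp
  then have "AE t in N. D t = 0"
    using integral_nonneg_eq_0_iff_AE[OF int_D D_nn] by simp
  with D_pos have "AE t in N. False"
    by eventually_elim simp
  with N_not_null show False ..
qed

lemma dual_bounded_and_uniquely_attained: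
  assumes pos: "strictly_positive_on T I g"
  shows "(\<exists>C::real. \<forall>l \<in> coeff_space I. dual l \<le> ereal C) \<and>
    (\<exists>!l. l \<in> coeff_space I \<and> dual l = (SUP l' \<in> coeff_space I. dual l'))"
proof
  obtain v where v: "v \<in> coeff_space I" "\<And>l. dual l \<le> dual v"
    using dual_attains_maximum[OF pos] by blast
  have "dual v \<le> ereal (pairing v)"
    unfolding dual_eq by (cases "normalizer v") (auto simp: enn2ereal_ennreal)
  then have "dual l \<le> ereal (pairing v)" for l
    by (rule order_trans[OF v(2)])
  then show "\<exists>C::real. \<forall>l \<in> coeff_space I. dual l \<le> ereal C"
    by (intro exI ballI)
  have sup: "(SUP l' \<in> coeff_space I. dual l') = dual v"
  proof (rule antisym)
    show "(SUP l' \<in> coeff_space I. dual l') \<le> dual v"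
      by (rule SUP_least) (rule v(2))
    show "dual v \<le> (SUP l' \<in> coeff_space I. dual l')"
      by (rule SUP_upper[OF v(1)])
  qed
  show "\<exists>!l. l \<in> coeff_space I \<and> dual l = (SUP l' \<in> coeff_space I. dual l')"
    unfolding sup
  proof (rule ex1I[of _ v])
    fix l
    assume l: "l \<in> coeff_space I \<and> dual l = dual v"
    show "l = v"
    proof (rule dual_maximum_unique[OF _ v(1) _ v(2)])
      show "l \<in> coeff_space I"
        using l by blast
      show "dual l' \<le> dual l" for l'
        unfolding conjunct2[OF l] by (rule v(2))
    qed
  qed (simp add: v(1))
qed

text \<open>A polynomial \<open>p\<^sub>a\<close> that violates strict positivity could be added to the maximizer without
  lowering the value, so the maximizer would not be unique.\<close>

lemma strictly_positive_if_unique_maximum: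
  assumes uniq: "\<exists>!l. l \<in> coeff_space I \<and> dual l = (SUP l' \<in> coeff_space I. dual l')"
  shows "strictly_positive_on T I g"
  unfolding strictly_positive_on_def
proof (intro allI impI)
  fix a
  assume nz: "\<exists>i\<in>I. a i \<noteq> 0" and le: "\<forall>t\<in>T. mpoly I a t \<le> 0"
  obtain l where l: "l \<in> coeff_space I" "dual l = (SUP l' \<in> coeff_space I. dual l')"
    and only: "\<forall>m. m \<in> coeff_space I \<and> dual m = (SUP l' \<in> coeff_space I. dual l') \<longrightarrow> m = l"
    using uniq by (elim ex1E conjE)
  show "pairing a < 0"
  proof (rule ccontr)
    assume "\<not> pairing a < 0"
    then have a: "0 \<le> pairing a" by simp
    define l1 where "l1 = (\<lambda>i\<in>I. l i + a i)"
    have l1: "l1 \<in> coeff_space I"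
      by (simp add: l1_def)
    have "mpoly I l1 t = mpoly I l t + mpoly I a t" for t
      by (simp add: mpoly_def l1_def distrib_right sum.distrib)
    then have "AE t in N. ennreal (exp (mpoly I l1 t) * \<rho> t) \<le> ennreal (exp (mpoly I l t) * \<rho> t)"
      using weight_pos AE_on_T[of "\<lambda>t. mpoly I a t \<le> 0"] le
      by (auto elim!: eventually_elim2 intro!: ennreal_leI mult_right_mono)
    then have "normalizer l1 \<le> normalizer l"
      unfolding normalizer_def by (rule nn_integral_mono_AE)
    moreover have "pairing l1 = pairing l + pairing a"
      by (simp add: l1_def distrib_left sum.distrib)
    ultimately have "dual l \<le> dual l1"
      unfolding dual_eq using a by (intro ereal_minus_mono) (auto simp: less_eq_ennreal.rep_eq)
    then have "dual l1 = (SUP l' \<in> coeff_space I. dual l')"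
      unfolding l(2) by (intro antisym SUP_upper l1)
    with l1 have "l1 = l"
      by (intro only[rule_format] conjI)
    then have "a i = 0" if "i \<in> I" for i
    proof -
      have "l1 i = l i + a i"
        using that by (simp add: l1_def)
      with \<open>l1 = l\<close> show ?thesis by simp
    qed
    with nz show False by blast
  qed
qed

end

section \<open>A density from a maximizer for a damped weight\<close>

lemma exp_quadratic_upper_bound:
  fixes x :: real
  shows "exp x \<le> 1 + x + x\<^sup>2 * exp \<bar>x\<bar>"
proof -
  obtain y where y: "\<bar>y\<bar> \<le> \<bar>x\<bar>" "exp x = (\<Sum>m<2. x ^ m / fact m) + exp y / fact 2 * x ^ 2"
    using Maclaurin_exp_le[of x 2] by blast
  have "exp y \<le> exp \<bar>x\<bar>"
    using y(1) by simp
  then have "x\<^sup>2 * exp y \<le> x\<^sup>2 * exp \<bar>x\<bar>"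
    by (rule mult_left_mono) simp
  moreover have "0 \<le> x\<^sup>2 * exp \<bar>x\<bar>"
    by simp
  moreover have "exp x = 1 + x + x\<^sup>2 * exp y / 2"
    using y(2) by (simp add: numeral_2_eq_2 mult.commute)
  ultimately show ?thesis
    by linarith
qed

lemma exp_abs_le: "exp \<bar>x\<bar> \<le> exp x + exp (- x)" for x :: real
  by (cases "0 \<le> x") auto

text \<open>The form in which the gradient at the maximizer is seen to vanish: it replaces
  differentiation under the integral sign.\<close>

lemma linear_le_quadratic_imp_zero:
  fixes d B :: real
  assumes "\<And>s. \<bar>s\<bar> \<le> 1 \<Longrightarrow> s * d \<le> s\<^sup>2 * B" and "0 \<le> B"
  shows "d = 0"
proof (rule ccontr)
  assume d: "d \<noteq> 0"
  \<comment> \<open>\<open>s = d / q\<close> is admissible, and the inequality at this point becomes \<open>q \<le> B\<close>\<close>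
  define q where "q = 1 + \<bar>d\<bar> + B"
  have q: "0 < q" "\<bar>d\<bar> \<le> q" "B < q"
    using assms(2) by (auto simp: q_def)
  have "d / q * d \<le> (d / q)\<^sup>2 * B"
    using q by (intro assms(1)) (simp add: abs_divide)
  then have "d\<^sup>2 * q \<le> d\<^sup>2 * B"
    using q(1) by (simp add: power2_eq_square field_simps)
  with d q(3) show False by simp
qed

context moment_setting
begin

text \<open>Completing squares, \<open>p\<^sub>l(t) - \<Sum> (t\<^sup>i)\<^sup>2 \<le> \<Sum> l\<^sub>i\<^sup>2 / 4\<close>, so for the damped weight
  \<open>\<sigma> = \<rho> exp (- \<Sum> (t\<^sup>i)\<^sup>2)\<close> all exponential integrals converge and the maximizer \<open>l\<close> can be varied
  in both directions of every coordinate \<open>j\<close>. With \<open>x = t\<^sup>j\<close> and \<open>f = exp p\<^sub>l \<sigma>\<close>, maximality gives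
  \<open>s g\<^sub>j \<le> \<integral> (exp (s x) - 1) f\<close>, and expanding the exponential to second order in \<open>s\<close> identifies
  \<open>g\<^sub>j\<close> with \<open>\<integral> x f\<close>.\<close>

lemma moments_if_strictly_positive:
  fixes \<rho> :: "real ^ 'n \<Rightarrow> real"
  assumes "integrable N \<rho>" and "AE t in N. \<rho> t > 0" and pos: "strictly_positive_on T I g"
  shows "\<exists>f \<in> L1_nonneg T. has_moments T I g f"
proof -
  define q where "q t = (\<Sum>i\<in>I. (mpow t i)\<^sup>2)" for t :: "real ^ 'n"
  define \<sigma> where "\<sigma> t = exp (- q t) * \<rho> t" for t
  have [measurable]: "\<rho> \<in> borel_measurable N"
    using assms(1) by auto
  have q_meas [measurable]: "q \<in> borel_measurable N"
    unfolding q_def by measurable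
  have tilted: "integrable N (\<lambda>t. exp (mpoly I l t) * \<sigma> t)" for l
  proof (rule Bochner_Integration.integrable_bound)
    show "integrable N (\<lambda>t. exp (\<Sum>i\<in>I. (l i)\<^sup>2 / 4) * \<rho> t)"
      using assms(1) by simp
    show "(\<lambda>t. exp (mpoly I l t) * \<sigma> t) \<in> borel_measurable N"
      unfolding \<sigma>_def by measurable
    have "mpoly I l t - q t \<le> (\<Sum>i\<in>I. (l i)\<^sup>2 / 4)" for t
    proof -
      have "l i * mpow t i - (mpow t i)\<^sup>2 \<le> (l i)\<^sup>2 / 4" for i
        using zero_le_power2[of "l i / 2 - mpow t i"] by (simp add: power2_eq_square algebra_simps)
      then show ?thesis
        unfolding mpoly_def q_def by (simp add: sum_mono flip: sum_subtractf)
    qed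
    then have "exp (mpoly I l t) * exp (- q t) \<le> exp (\<Sum>i\<in>I. (l i)\<^sup>2 / 4)" for t
      by (simp flip: exp_add)
    then show "AE t in N. norm (exp (mpoly I l t) * \<sigma> t) \<le> norm (exp (\<Sum>i\<in>I. (l i)\<^sup>2 / 4) * \<rho> t)"
      by (intro AE_I2) (simp add: \<sigma>_def abs_mult mult_right_mono flip: mult.assoc)
  qed
  have \<sigma>_pos: "AE t in N. \<sigma> t > 0"
    using assms(2) by (auto simp: \<sigma>_def elim: eventually_mono)
  interpret W: weighted_moment_setting T I g \<sigma>
    using tilted[of "\<lambda>_. 0"] \<sigma>_pos by unfold_locales (simp_all add: mpoly_def)
  obtain l where max: "\<And>l'. W.dual l' \<le> W.dual l"
    using W.dual_attains_maximum[OF pos] by blast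
  define f where "f t = exp (mpoly I l t) * \<sigma> t" for t
  have f_pos: "AE t in N. 0 \<le> f t"
    using \<sigma>_pos by (auto simp: f_def elim: eventually_mono)
  have f_int: "integrable N f"
    unfolding f_def by (rule tilted)
  have [measurable]: "f \<in> borel_measurable N"
    using f_int by auto
  have moment: "integrable N (\<lambda>t. \<bar>mpow t j\<bar> * f t) \<and> integral\<^sup>L N (\<lambda>t. mpow t j * f t) = g j"
    if j: "j \<in> I" for j
  proof -
    let ?x = "\<lambda>t. mpow t j"
    have shift: "(\<Sum>i\<in>I. (l(j := l j + s)) i * c i) = (\<Sum>i\<in>I. l i * c i) + s * c j" for s and c :: "nat ^ 'n \<Rightarrow> real"
      using finite_I j by (simp add: sum.remove[of I j] algebra_simps)
    have mpoly_shift: "mpoly I (l(j := l j + s)) t = mpoly I l t + s * ?x t" for s t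
      unfolding mpoly_def by (rule shift)
    have f_shift: "exp (mpoly I (l(j := l j + s)) t) * \<sigma> t = exp (s * ?x t) * f t" for s t
      by (simp add: mpoly_shift f_def exp_add)
    have pairing_shift: "pairing (l(j := l j + s)) = pairing l + s * g j" for s
      using shift[of s g] by (simp add: mult.commute)
    have exp_int: "integrable N (\<lambda>t. exp (s * ?x t) * f t)" for s
      using tilted[of "l(j := l j + s)"] by (simp only: f_shift)
    have abs_int: "integrable N (\<lambda>t. \<bar>?x t\<bar> * f t)"
    proof (rule Bochner_Integration.integrable_bound)
      show "integrable N (\<lambda>t. exp (1 * ?x t) * f t + exp (- 1 * ?x t) * f t)"
        by (intro Bochner_Integration.integrable_add exp_int)
      show "AE t in N. norm (\<bar>?x t\<bar> * f t) \<le> norm (exp (1 * ?x t) * f t + exp (- 1 * ?x t) * f t)"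
        using f_pos
      proof eventually_elim
        case (elim t)
        have "\<bar>?x t\<bar> \<le> exp (?x t) + exp (- ?x t)"
          using exp_ge_add_one_self[of "\<bar>?x t\<bar>"] exp_abs_le[of "?x t"] by linarith
        then have "\<bar>?x t\<bar> * f t \<le> (exp (?x t) + exp (- ?x t)) * f t"
          using elim by (rule mult_right_mono)
        then show ?case
          using elim by (simp add: distrib_right abs_mult)
      qed
    qed measurable
    have sq_int: "integrable N (\<lambda>t. (?x t)\<^sup>2 * exp \<bar>?x t\<bar> * f t)"
    proof (rule Bochner_Integration.integrable_bound)
      show "integrable N (\<lambda>t. 2 * (exp (2 * ?x t) * f t + exp (- 2 * ?x t) * f t))"
        by (intro integrable_mult_right Bochner_Integration.integrable_add exp_int)
      show "AE t in N. norm ((?x t)\<^sup>2 * exp \<bar>?x t\<bar> * f t)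
          \<le> norm (2 * (exp (2 * ?x t) * f t + exp (- 2 * ?x t) * f t))"
        using f_pos
      proof eventually_elim
        case (elim t)
        have "(?x t)\<^sup>2 \<le> 2 * exp \<bar>?x t\<bar>"
          using exp_lower_Taylor_quadratic[of "\<bar>?x t\<bar>"] by simp
        then have "(?x t)\<^sup>2 * exp \<bar>?x t\<bar> \<le> 2 * exp \<bar>?x t\<bar> * exp \<bar>?x t\<bar>"
          by (rule mult_right_mono) simp
        also have "\<dots> = 2 * exp \<bar>2 * ?x t\<bar>"
          by (simp add: abs_mult flip: exp_add)
        also have "\<dots> \<le> 2 * (exp (2 * ?x t) + exp (- 2 * ?x t))"
          using exp_abs_le[of "2 * ?x t"] by simp
        finally have "(?x t)\<^sup>2 * exp \<bar>?x t\<bar> * f t \<le> 2 * (exp (2 * ?x t) + exp (- 2 * ?x t)) * f t"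
          using elim by (rule mult_right_mono)
        then show ?case
          using elim by (simp add: algebra_simps abs_mult)
      qed
    qed measurable
    have mom_int: "integrable N (\<lambda>t. ?x t * f t)"
      by (rule Bochner_Integration.integrable_bound[OF abs_int]) (auto simp: abs_mult)
    define m where "m = (\<integral>t. ?x t * f t \<partial>N)"
    define B where "B = (\<integral>t. (?x t)\<^sup>2 * exp \<bar>?x t\<bar> * f t \<partial>N)"
    have "g j - m = 0"
    proof (rule linear_le_quadratic_imp_zero)
      show "0 \<le> B"
        unfolding B_def using f_pos by (intro integral_nonneg_AE) (auto elim: eventually_mono)
      fix s :: real
      assume s: "\<bar>s\<bar> \<le> 1"
      have "W.dual (l(j := l j + s)) = ereal (pairing l + s * g j - (\<integral>t. exp (s * ?x t) * f t \<partial>N))"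
        using W.dual_finite_normalizer[OF tilted] by (simp only: f_shift pairing_shift)
      moreover have "W.dual l = ereal (pairing l - (\<integral>t. f t \<partial>N))"
        using W.dual_finite_normalizer[OF tilted, of l] by (simp add: f_def)
      ultimately have "s * g j \<le> (\<integral>t. exp (s * ?x t) * f t \<partial>N) - (\<integral>t. f t \<partial>N)"
        using max[of "l(j := l j + s)"] by simp
      also have "(\<integral>t. exp (s * ?x t) * f t \<partial>N)
          \<le> (\<integral>t. f t + s * (?x t * f t) + s\<^sup>2 * ((?x t)\<^sup>2 * exp \<bar>?x t\<bar> * f t) \<partial>N)"
      proof (rule integral_mono_AE)
        show "integrable N (\<lambda>t. f t + s * (?x t * f t) + s\<^sup>2 * ((?x t)\<^sup>2 * exp \<bar>?x t\<bar> * f t))"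
          using f_int mom_int sq_int by (intro Bochner_Integration.integrable_add integrable_mult_right)
        show "AE t in N. exp (s * ?x t) * f t
            \<le> f t + s * (?x t * f t) + s\<^sup>2 * ((?x t)\<^sup>2 * exp \<bar>?x t\<bar> * f t)"
          using f_pos
        proof eventually_elim
          case (elim t)
          have "\<bar>s * ?x t\<bar> \<le> \<bar>?x t\<bar>"
            using s by (simp add: abs_mult mult_left_le_one_le)
          then have "(s * ?x t)\<^sup>2 * exp \<bar>s * ?x t\<bar> \<le> (s * ?x t)\<^sup>2 * exp \<bar>?x t\<bar>"
            by (intro mult_left_mono) auto
          then have "exp (s * ?x t) \<le> 1 + s * ?x t + s\<^sup>2 * (?x t)\<^sup>2 * exp \<bar>?x t\<bar>"
            using exp_quadratic_upper_bound[of "s * ?x t"] by (simp add: power_mult_distrib)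
          then have "exp (s * ?x t) * f t \<le> (1 + s * ?x t + s\<^sup>2 * (?x t)\<^sup>2 * exp \<bar>?x t\<bar>) * f t"
            using elim by (rule mult_right_mono)
          then show ?case
            by (simp add: algebra_simps)
        qed
      qed (rule exp_int)
      also have "\<dots> = (\<integral>t. f t \<partial>N) + s * m + s\<^sup>2 * B"
        using f_int mom_int sq_int by (simp add: m_def B_def)
      finally show "s * (g j - m) \<le> s\<^sup>2 * B"
        by (simp add: algebra_simps)
    qed
    with abs_int show ?thesis
      by (simp add: m_def)
  qed
  show ?thesis
  proof
    show "f \<in> L1_nonneg T"
      using f_int f_pos by (simp add: L1_nonneg_def)
    show "has_moments T I g f"
      using moment by (simp add: has_moments_def)
  qed
qed

end

theorem theorem3:
  fixes T :: "(real ^ 'n) set"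
    and I :: "(nat ^ 'n) set"
    and k :: nat
    and g :: "nat ^ 'n \<Rightarrow> real"
    and \<rho> :: "real ^ 'n \<Rightarrow> real"
  assumes "T \<noteq> {}" and "closed T" and "regular_domain T"
    and "finite I" and "regular_indices I" and "0 \<in> I"
    and "k \<ge> 1" and "Max (mdeg ` I) = 2 * k"
    and "\<And>\<iota>. (2 * k) *s axis \<iota> 1 \<in> I"
    and "g 0 = 1"
    and "integrable (lebesgue_on T) \<rho>" and "AE t in lebesgue_on T. \<rho> t > 0"
  shows "(\<exists>f \<in> L1_nonneg T. has_moments T I g f) \<longleftrightarrow>
         (\<exists>C::real. \<forall>l \<in> coeff_space I. dual_functional T I g \<rho> l \<le> ereal C) \<and>
         (\<exists>!l. l \<in> coeff_space I \<and>
            dual_functional T I g \<rho> l = (SUP l' \<in> coeff_space I. dual_functional T I g \<rho> l'))"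
proof -
  interpret weighted_moment_setting T I g \<rho>
    using assms by unfold_locales auto
  show ?thesis
  proof
    assume "\<exists>f \<in> L1_nonneg T. has_moments T I g f"
    then obtain f where "f \<in> L1_nonneg T" "has_moments T I g f"
      by (elim bexE)
    then have "strictly_positive_on T I g"
      by (rule strictly_positive_if_moments[OF assms(6,10)])
    then show "(\<exists>C::real. \<forall>l \<in> coeff_space I. dual l \<le> ereal C) \<and>
        (\<exists>!l. l \<in> coeff_space I \<and> dual l = (SUP l' \<in> coeff_space I. dual l'))"
      by (rule dual_bounded_and_uniquely_attained)
  next
    assume "(\<exists>C::real. \<forall>l \<in> coeff_space I. dual l \<le> ereal C) \<and>
        (\<exists>!l. l \<in> coeff_space I \<and> dual l = (SUP l' \<in> coeff_space I. dual l'))"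
    then have "strictly_positive_on T I g"
      by (intro strictly_positive_if_unique_maximum) (rule conjunct2)
    then show "\<exists>f \<in> L1_nonneg T. has_moments T I g f"
      by (rule moments_if_strictly_positive[OF assms(11,12)])
  qed
qed

end
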